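(* Let $w,n$ be positive integers and let $\mathbf{P}=(X,\leq)$ be a poset of width $w$ and cardinality $|X|\leq n$. Then the number $|\mathcal{AC}^s(\mathbf{P})|$ of strict alternating cycles of $\mathbf{P}$ satisfies $$|\mathcal{AC}^s(\mathbf{P})| \leq s_w(n):= \sum_{k=2}^w(k-1)!\binom{w}{k}\left(\frac{n(n+w)}{2w^2}\right)^{k}.$$
   Context: All posets are finite with nonempty ground set, and partial orders $\leq$ are reflexive. The width of a poset is the number of elements of its largest antichain. For a poset $\mathbf{P}=(X,\leq)$, $\mathrm{inc}(\mathbf{P})$ is the set of ordered pairs $(x,y)$ of elements of $X$ that are incomparable. An alternating cycle of $\mathbf{P}$ is a cyclically ordered tuple $S=[(x_1,y_1),\ldots,(x_k,y_k)]$ with each $(x_i,y_i)\in\mathrm{inc}(\mathbf{P})$ and $y_i\leq x_{i+1}$ for every $i$, indices modulo $k$; two such tuples of the same length $k$ are considered identical iff they differ by a cyclic shift of the index. It is strict if $y_i\leq x_j$ implies $j=i+1$ modulo $k$. $\mathcal{AC}^s(\mathbf{P})$ denotes the set of strict alternating cycles of $\mathbf{P}$. *)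

theory Defs
  imports Complex_Main "HOL-Number_Theory.Cong"
begin

text \<open>
  A finite poset is a finite nonempty set X together with a relation r such that
  \<^term>\<open>partial_order_on X r\<close>; here \<^term>\<open>(x, y) \<in> r\<close> means that x is below or equal to y.
\<close>

definition inc :: "'a set \<Rightarrow> 'a rel \<Rightarrow> ('a \<times> 'a) set" where
  "inc X r = {(x, y). x \<in> X \<and> y \<in> X \<and> (x, y) \<notin> r \<and> (y, x) \<notin> r}"

definition antichain_in :: "'a set \<Rightarrow> 'a rel \<Rightarrow> 'a set \<Rightarrow> bool" where
  "antichain_in X r A \<longleftrightarrow> A \<subseteq> X \<and> (\<forall>x\<in>A. \<forall>y\<in>A. x \<noteq> y \<longrightarrow> (x, y) \<in> inc X r)"

definition poset_width :: "'a set \<Rightarrow> 'a rel \<Rightarrow> nat" where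
  "poset_width X r = Max (card ` {A. antichain_in X r A})"

text \<open>
  No lower bound on the length k of an alternating cycle is needed: a nonempty tuple of length 1
  would require y to be below x for an incomparable pair (x, y).
\<close>

definition alternating_tuple :: "'a set \<Rightarrow> 'a rel \<Rightarrow> ('a \<times> 'a) list \<Rightarrow> bool" where
  "alternating_tuple X r S \<longleftrightarrow>
     S \<noteq> [] \<and> set S \<subseteq> inc X r \<and>
     (\<forall>i < length S. (snd (S ! i), fst (S ! (Suc i mod length S))) \<in> r)"

definition strict_alternating_tuple :: "'a set \<Rightarrow> 'a rel \<Rightarrow> ('a \<times> 'a) list \<Rightarrow> bool" where
  "strict_alternating_tuple X r S \<longleftrightarrow>
     alternating_tuple X r S \<and>
     (\<forall>i < length S. \<forall>j < length S.
        (snd (S ! i), fst (S ! j)) \<in> r \<longrightarrow> j = Suc i mod length S)"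

definition cyclic_shift :: "'b list rel" where
  "cyclic_shift = {(S, T). \<exists>m. T = rotate m S}"

lemma equiv_cyclic_shift: "equiv UNIV cyclic_shift"
proof (rule equivI)
  show "refl cyclic_shift"
    unfolding cyclic_shift_def refl_on_def by (auto intro: exI[of _ 0])
  show "sym cyclic_shift"
  proof (rule symI)
    fix S T :: "'b list"
    assume "(S, T) \<in> cyclic_shift"
    then obtain m where T: "T = rotate m S" unfolding cyclic_shift_def by blast
    have "rotate (length S - m mod length S) T = S"
    proof (cases "S = []")
      case False
      then have "m mod length S < length S" by simp
      moreover have "T = rotate (m mod length S) S"
        using T rotate_conv_mod by metis
      ultimately show ?thesis by (simp add: rotate_rotate)
    qed (simp add: T)
    then show "(T, S) \<in> cyclic_shift" unfolding cyclic_shift_def by (metis (mono_tags, lifting) case_prodI mem_Collect_eq)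
  qed
  show "trans cyclic_shift"
    unfolding cyclic_shift_def trans_def by (auto simp: rotate_rotate)
qed auto

lemma strict_alternating_tuple_rotate:
  assumes "strict_alternating_tuple X r S"
  shows "strict_alternating_tuple X r (rotate m S)"
proof -
  let ?k = "length S"
  have k: "?k > 0"
    and inc: "set S \<subseteq> inc X r"
    and alt: "\<And>i. i < ?k \<Longrightarrow> (snd (S ! i), fst (S ! (Suc i mod ?k))) \<in> r"
    and strict: "\<And>i j. i < ?k \<Longrightarrow> j < ?k \<Longrightarrow> (snd (S ! i), fst (S ! j)) \<in> r \<Longrightarrow> j = Suc i mod ?k"
    using assms unfolding strict_alternating_tuple_def alternating_tuple_def by auto
  have step: "(m + Suc i mod ?k) mod ?k = Suc ((m + i) mod ?k) mod ?k" for i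
    by (simp add: mod_simps)
  have inj: "j = Suc i mod ?k"
    if "j < ?k" and "(m + j) mod ?k = (m + Suc i mod ?k) mod ?k" for i j
  proof -
    have "j mod ?k = (Suc i mod ?k) mod ?k"
      using that(2) by (metis cong_add_lcancel_nat cong_def)
    then show ?thesis using that(1) by simp
  qed
  have "(snd (rotate m S ! i), fst (rotate m S ! (Suc i mod ?k))) \<in> r" if "i < ?k" for i
    using alt[of "(m + i) mod ?k"] k that by (simp add: nth_rotate step)
  moreover have "j = Suc i mod ?k"
    if "i < ?k" "j < ?k" "(snd (rotate m S ! i), fst (rotate m S ! j)) \<in> r" for i j
    using strict[of "(m + i) mod ?k" "(m + j) mod ?k"] k that
    by (intro inj) (simp_all add: nth_rotate step)
  ultimately show ?thesis
    using k inc unfolding strict_alternating_tuple_def alternating_tuple_def by auto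
qed

definition strict_alternating_cycles :: "'a set \<Rightarrow> 'a rel \<Rightarrow> ('a \<times> 'a) list set set" where
  "strict_alternating_cycles X r = {S. strict_alternating_tuple X r S} // cyclic_shift"

definition s_bound :: "nat \<Rightarrow> nat \<Rightarrow> real" where
  "s_bound w n =
     (\<Sum>k = 2..w. fact (k - 1) * real (w choose k) *
        (real n * (real n + real w) / (2 * (real w)\<^sup>2)) ^ k)"

end

theory Submission
  imports Defs "HOL-Library.FuncSet"
begin

text \<open>
  Let \<open>S = [(x\<^sub>1, y\<^sub>1), \<dots>, (x\<^sub>k, y\<^sub>k)]\<close> be a strict alternating cycle and \<open>U\<close> its support, the set of
  all \<open>x\<^sub>i\<close> and \<open>y\<^sub>i\<close>. The \<open>x\<^sub>i\<close> form an antichain of size \<open>k\<close>, and so do the \<open>y\<^sub>i\<close>. The \<open>x\<^sub>i\<close> are the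
  maximal elements of \<open>U\<close> (\<open>maximals_support\<close>), and once their cyclic order is known, \<open>U\<close> determines the
  whole cycle (\<open>tuple_eqI\<close>). So each \<open>U\<close> is the support of at most \<open>(k - 1)!\<close> cycles.

  By Dilworth's theorem \<open>X\<close> is partitioned into \<open>w\<close> chains, of sizes \<open>c\<^sub>1, \<dots>, c\<^sub>w\<close>. The set \<open>U\<close> meets each
  chain in at most two elements, and it meets at least \<open>k\<close> chains because the \<open>x\<^sub>i\<close> lie in different ones.
  The number of cycles is therefore at most the sum of \<open>(j - 1)!\<close> over all sets \<open>U\<close> that meet exactly
  \<open>j \<ge> 2\<close> chains, each in at most two elements
  (\<open>card_strict_alternating_cycles_le\<close>). With \<open>f(c) = c (c + 1) / 2\<close>, the number of ways to choose one or two
  elements from a chain of size \<open>c\<close>, this sum equals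
  \<open>G(c\<^sub>1, \<dots>, c\<^sub>w) = \<Sum>\<^sub>J (|J| - 1)! \<Prod>\<^bsub>i\<in>J\<^esub> f(c\<^sub>i)\<close>,
  where \<open>J\<close> runs over the sets of at least two chains.

  Finally \<open>G\<close> is largest when all chains have the same (real) size \<open>|X| / w \<le> n / w\<close>, which gives
  \<open>s\<^sub>w(n)\<close> because \<open>f\<close> is increasing. A single elementary symmetric polynomial of the \<open>f(c\<^sub>i)\<close>
  need not be largest there, since \<open>f\<close> is convex; but as the weights \<open>(j - 1)!\<close> do not decrease with \<open>j\<close>, a loss in the terms that are linear in two of the
  values \<open>f(c\<^sub>i)\<close> is made up for by their product (\<open>weighted_products_mono2\<close>, \<open>tri_smoothing\<close>). Moving two
  sizes towards each other thus increases \<open>G\<close> (\<open>weighted_products_le_balanced\<close>).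
\<close>

section \<open>Antichains and Dilworth's theorem\<close>

lemma antichain_in_iff:
  "antichain_in X r A \<longleftrightarrow> A \<subseteq> X \<and> (\<forall>x\<in>A. \<forall>y\<in>A. (x, y) \<in> r \<longrightarrow> x = y)"
  unfolding antichain_in_def inc_def by blast

lemma finite_antichains:
  assumes "finite X"
  shows "finite {A. antichain_in X r A}"
  by (rule finite_subset[of _ "Pow X"]) (use assms in \<open>auto simp: antichain_in_iff\<close>)

lemma finite_maximal_element:
  assumes "finite D" "D \<noteq> {}" "trans r" "antisym r"
  obtains m where "m \<in> D" "\<And>x. x \<in> D \<Longrightarrow> (m, x) \<in> r \<Longrightarrow> x = m"
proof -
  have "\<exists>m\<in>D. \<forall>x\<in>D. x \<noteq> m \<longrightarrow> \<not> ((m, x) \<in> r \<and> x \<noteq> m)"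
  proof (rule Finite_Set.bex_max_element[OF assms(1) _ _ assms(2)])
    show "asymp_on D (\<lambda>x y. (x, y) \<in> r \<and> y \<noteq> x)"
      using assms(4) by (auto simp: asymp_on_def dest: antisymD)
    show "transp_on D (\<lambda>x y. (x, y) \<in> r \<and> y \<noteq> x)"
      using assms(3,4) by (auto simp: transp_on_def dest: antisymD transD)
  qed
  then show thesis using that by blast
qed

text \<open>
  Dilworth's theorem, with the chain partition given as a colouring, by Galvin's induction: remove
  a maximal element \<open>a\<close> and colour the rest with as many chains as its width \<open>k\<close>. Every antichain of
  size \<open>k\<close> meets every chain, and the highest points where such antichains meet the chains form an
  antichain themselves. If \<open>a\<close> lies above one of them, \<open>a\<close> together with the part of that chain
  below this point is a chain that meets all antichains of size \<open>k\<close>, so removing it lowers the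
  width; otherwise \<open>a\<close> extends that antichain and a new chain \<open>{a}\<close> is affordable.
\<close>

lemma Dilworth_chain_colouring:
  assumes "finite X" "refl_on X r" "trans r" "antisym r"
    and "\<And>A. antichain_in X r A \<Longrightarrow> card A \<le> w"
  shows "\<exists>ch. ch ` X \<subseteq> {..<w} \<and>
    (\<forall>x\<in>X. \<forall>y\<in>X. ch x = ch y \<longrightarrow> (x, y) \<in> r \<or> (y, x) \<in> r)"
  using assms(1,2,5)
proof (induction X arbitrary: w rule: finite_psubset_induct)
  case (psubset X)
  note refl = \<open>refl_on X r\<close>
  show ?case
  proof (cases "X = {}")
    case True
    then show ?thesis by simp
  next
    case False
    obtain a where a: "a \<in> X" "\<And>x. x \<in> X \<Longrightarrow> (a, x) \<in> r \<Longrightarrow> x = a"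
      using finite_maximal_element[OF psubset.hyps False assms(3,4)] by blast
    define X' where "X' = X - {a}"
    define anti where "anti = {A. antichain_in X' r A}"
    have fin': "finite X'" using psubset.hyps by (simp add: X'_def)
    have fanti: "finite anti" using finite_antichains[OF fin'] by (simp add: anti_def)
    have "{} \<in> anti" by (simp add: anti_def antichain_in_iff)
    define k where "k = Max (card ` anti)"
    have "k \<in> card ` anti"
      unfolding k_def using fanti \<open>{} \<in> anti\<close> by (intro Max_in) auto
    then obtain A0 where A0: "antichain_in X' r A0" "card A0 = k" by (auto simp: anti_def)
    have k_max: "card A \<le> k" if "antichain_in X' r A" for A
      using that fanti by (simp add: k_def anti_def)
    have "antichain_in X r A0" using A0(1) by (auto simp: antichain_in_iff X'_def)
    then have kw: "k \<le> w" using psubset.prems(2) A0(2) by blast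
    have "X' \<subset> X" "refl_on X' r" using a(1) refl by (auto simp: X'_def refl_on_def)
    from psubset.IH[OF this k_max] obtain ch where ch: "ch ` X' \<subseteq> {..<k}"
      and chain: "\<And>x y. x \<in> X' \<Longrightarrow> y \<in> X' \<Longrightarrow> ch x = ch y \<Longrightarrow> (x, y) \<in> r \<or> (y, x) \<in> r"
      by blast
    have full: "ch ` A = {..<k}" if A: "antichain_in X' r A" "card A = k" for A
    proof (rule card_subset_eq)
      have "A \<subseteq> X'" using A by (simp add: antichain_in_iff)
      moreover have "inj_on ch A"
        using A(1) chain unfolding antichain_in_iff inj_on_def by (metis subsetD)
      ultimately show "card (ch ` A) = card {..<k}" "ch ` A \<subseteq> {..<k}"
        using A(2) ch by (auto simp: card_image)
    qed simp
    \<comment> \<open>The points of chain \<open>i\<close> that lie on some antichain of the largest size.\<close>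
    define D where "D i = {x \<in> X'. ch x = i \<and> (\<exists>A. antichain_in X' r A \<and> card A = k \<and> x \<in> A)}" for i
    have "\<exists>m. m \<in> D i \<and> (\<forall>x\<in>D i. (x, m) \<in> r)" if "i < k" for i
    proof -
      have "i \<in> ch ` A0" using full[OF A0] that by simp
      then have "D i \<noteq> {}" using A0 by (auto simp: D_def antichain_in_iff)
      moreover have "finite (D i)" using fin' by (simp add: D_def)
      ultimately obtain m where m: "m \<in> D i" "\<And>x. x \<in> D i \<Longrightarrow> (m, x) \<in> r \<Longrightarrow> x = m"
        using finite_maximal_element[OF _ _ assms(3,4)] by metis
      have "(x, m) \<in> r" if "x \<in> D i" for x
        using m that chain[of x m] by (auto simp: D_def)
      with m(1) show ?thesis by blast
    qed
    then obtain m where m: "\<And>i. i < k \<Longrightarrow> m i \<in> D i"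
      and m_top: "\<And>i x. i < k \<Longrightarrow> x \<in> D i \<Longrightarrow> (x, m i) \<in> r" by metis
    have m_ch: "m i \<in> X'" "ch (m i) = i" if "i < k" for i
      using m[OF that] by (auto simp: D_def)
    have m_anti: "i = j" if ij: "i < k" "j < k" "(m i, m j) \<in> r" for i j
    proof -
      obtain A where A: "antichain_in X' r A" "card A = k" "m j \<in> A"
        using m[OF ij(2)] by (auto simp: D_def)
      \<comment> \<open>The antichain through \<open>m j\<close> meets chain \<open>i\<close> at or below \<open>m i\<close>, hence below \<open>m j\<close>.\<close>
      then have "i \<in> ch ` A" using full ij(1) by simp
      then obtain y where y: "y \<in> A" "ch y = i" by blast
      then have "y \<in> D i" using A by (auto simp: D_def antichain_in_iff)
      then have "(y, m j) \<in> r" using m_top[OF ij(1)] ij(3) assms(3) by (meson transD)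
      then have "y = m j" using A y by (auto simp: antichain_in_iff)
      then show ?thesis using y(2) m_ch(2)[OF ij(2)] by simp
    qed
    show ?thesis
    proof (cases "\<exists>i<k. (m i, a) \<in> r")
      case True
      then obtain i where i: "i < k" "(m i, a) \<in> r" by blast
      define K where "K = insert a {z \<in> X'. ch z = i \<and> (z, m i) \<in> r}"
      have K_chain: "(x, y) \<in> r \<or> (y, x) \<in> r" if "x \<in> K" "y \<in> K" for x y
      proof -
        have below: "(z, a) \<in> r" if "z \<in> K" for z
          using that i(2) a(1) refl assms(3) unfolding K_def refl_on_def by (blast dest: transD)
        show ?thesis
          using that below chain[of x y] by (cases "x = a \<or> y = a") (auto simp: K_def)
      qed
      have small: "card A \<le> k - 1" if A: "antichain_in (X - K) r A" for A
      proof -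
        have A': "antichain_in X' r A" using A by (auto simp: antichain_in_iff X'_def K_def)
        have "card A \<noteq> k"
        proof
          assume cA: "card A = k"
          then have "i \<in> ch ` A" using full[OF A'] i(1) by simp
          then obtain z where z: "z \<in> A" "ch z = i" by blast
          then have "z \<in> D i" using A' cA by (auto simp: D_def antichain_in_iff)
          then have "z \<in> K" using m_top[OF i(1)] by (auto simp: K_def D_def)
          then show False using A z(1) by (auto simp: antichain_in_iff)
        qed
        then show ?thesis using k_max[OF A'] by simp
      qed
      have "X - K \<subset> X" "refl_on (X - K) r"
        using a(1) refl by (auto simp: K_def refl_on_def)
      from psubset.IH[OF this small] obtain ch' where ch': "ch' ` (X - K) \<subseteq> {..<k - 1}"
        and chain': "\<And>x y. x \<in> X - K \<Longrightarrow> y \<in> X - K \<Longrightarrow> ch' x = ch' y \<Longrightarrow> (x, y) \<in> r \<or> (y, x) \<in> r"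
        by blast
      have lt: "ch' x < k - 1" if "x \<in> X" "x \<notin> K" for x
        using ch' that by blast
      show ?thesis
      proof (intro exI conjI ballI impI)
        show "(\<lambda>x. if x \<in> K then k - 1 else ch' x) ` X \<subseteq> {..<w}"
        proof (rule image_subsetI)
          fix x assume "x \<in> X"
          then show "(if x \<in> K then k - 1 else ch' x) \<in> {..<w}"
            using lt[of x] i(1) kw by auto
        qed
        fix x y
        assume "x \<in> X" "y \<in> X" "(if x \<in> K then k - 1 else ch' x) = (if y \<in> K then k - 1 else ch' y)"
        then show "(x, y) \<in> r \<or> (y, x) \<in> r"
          using lt[of x] lt[of y] K_chain chain'[of x y] by (auto split: if_splits)
      qed
    next
      case False
      define A where "A = insert a (m ` {..<k})"
      have "antichain_in X r A"
        using False a m_ch m_anti unfolding A_def antichain_in_iff X'_def by blast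
      moreover have "card A = Suc k"
      proof -
        have "a \<notin> m ` {..<k}" using m_ch by (auto simp: X'_def)
        moreover have "inj_on m {..<k}" using m_ch by (metis inj_onI lessThan_iff)
        ultimately show ?thesis by (simp add: A_def card_image)
      qed
      ultimately have "Suc k \<le> w" using psubset.prems(2) by metis
      show ?thesis
      proof (intro exI conjI ballI impI)
        show "(\<lambda>x. if x = a then k else ch x) ` X \<subseteq> {..<w}"
          using ch \<open>Suc k \<le> w\<close> by (fastforce simp: X'_def)
        fix x y
        assume *: "x \<in> X" "y \<in> X" "(if x = a then k else ch x) = (if y = a then k else ch y)"
        have "ch z < k" if "z \<in> X" "z \<noteq> a" for z using ch that by (auto simp: X'_def)
        then show "(x, y) \<in> r \<or> (y, x) \<in> r"
          using * a(1) refl chain[of x y] by (fastforce simp: X'_def refl_on_def split: if_splits)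
      qed
    qed
  qed
qed

lemma poset_width_attained:
  assumes "finite X"
  obtains A where "antichain_in X r A" "card A = poset_width X r"
proof -
  have "finite {A. antichain_in X r A}" using finite_antichains[OF assms] .
  moreover have "{} \<in> {A. antichain_in X r A}" by (simp add: antichain_in_iff)
  ultimately have "poset_width X r \<in> card ` {A. antichain_in X r A}"
    unfolding poset_width_def by (intro Max_in) auto
  then show thesis using that by force
qed

lemma card_antichain_le_poset_width:
  assumes "finite X" "antichain_in X r A"
  shows "card A \<le> poset_width X r"
  unfolding poset_width_def using finite_antichains[OF assms(1)] assms(2) by (intro Max_ge) auto

section \<open>The support of a strict alternating cycle\<close>

definition support :: "('a \<times> 'a) list \<Rightarrow> 'a set" where
  "support S = fst ` set S \<union> snd ` set S"

definition maximals :: "'a rel \<Rightarrow> 'a set \<Rightarrow> 'a set" where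
  "maximals r U = {u \<in> U. \<forall>v\<in>U. (u, v) \<in> r \<longrightarrow> v = u}"

lemma support_rotate [simp]: "support (rotate m S) = support S"
  by (simp add: support_def)

lemma Suc_mod_less: "i < k \<Longrightarrow> Suc i mod k < k"
  by simp

lemma Suc_mod_inj:
  assumes "i < k" "j < k" "Suc i mod k = Suc j mod k"
  shows "i = j"
  using assms by (auto simp: mod_Suc split: if_splits)

lemma Suc_mod_surj:
  assumes "i < k"
  obtains j where "j < k" "Suc j mod k = i"
proof (cases i)
  case 0
  then show ?thesis using assms that[of "k - 1"] by simp
next
  case (Suc j)
  then show ?thesis using assms that[of j] by simp
qed

lemma strict_alternating_tupleD:
  assumes "strict_alternating_tuple X r S"
  shows "set S \<subseteq> inc X r" and "0 < length S"
    and "i < length S \<Longrightarrow> (snd (S ! i), fst (S ! (Suc i mod length S))) \<in> r"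
    and "i < length S \<Longrightarrow> j < length S \<Longrightarrow> (snd (S ! i), fst (S ! j)) \<in> r
      \<Longrightarrow> j = Suc i mod length S"
  using assms unfolding strict_alternating_tuple_def alternating_tuple_def by auto

lemma support_subset:
  assumes "strict_alternating_tuple X r S"
  shows "support S \<subseteq> X"
  using strict_alternating_tupleD(1)[OF assms] by (auto simp: support_def inc_def)

lemma in_supportE:
  assumes "u \<in> support S"
  obtains i where "i < length S" "u = fst (S ! i)" | i where "i < length S" "u = snd (S ! i)"
  using assms unfolding support_def in_set_conv_nth by (auto simp: in_set_conv_nth)

text \<open>
  A tuple of length one would make the two members of an incomparable pair comparable.
\<close>

lemma strict_alternating_tuple_length_ge_2:
  assumes "strict_alternating_tuple X r S"
  shows "2 \<le> length S"
proof (rule ccontr)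
  assume "\<not> 2 \<le> length S"
  then have "length S = 1" using strict_alternating_tupleD(2)[OF assms] by linarith
  moreover have "S ! 0 \<in> inc X r"
    using strict_alternating_tupleD(1,2)[OF assms] nth_mem by blast
  ultimately show False
    using strict_alternating_tupleD(3)[OF assms, of 0] by (auto simp: inc_def)
qed

text \<open>
  If \<open>x\<^sub>i \<le> x\<^sub>j\<close> then \<open>y\<^bsub>i-1\<^esub> \<le> x\<^sub>j\<close>, which strictness permits only for \<open>j = i\<close>. The dual argument
  applies to the second components.
\<close>

lemma fst_antichain:
  assumes "trans r" "strict_alternating_tuple X r S"
    and "i < length S" "j < length S" "(fst (S ! i), fst (S ! j)) \<in> r"
  shows "i = j"
proof -
  obtain l where l: "l < length S" "Suc l mod length S = i"
    using Suc_mod_surj[OF assms(3)] .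
  then have "(snd (S ! l), fst (S ! i)) \<in> r"
    using strict_alternating_tupleD(3)[OF assms(2), of l] by simp
  with assms(1,5) have "(snd (S ! l), fst (S ! j)) \<in> r" by (blast dest: transD)
  then show ?thesis
    using strict_alternating_tupleD(4)[OF assms(2) l(1) assms(4)] l(2) by simp
qed

lemma snd_antichain:
  assumes "trans r" "strict_alternating_tuple X r S"
    and "i < length S" "j < length S" "(snd (S ! i), snd (S ! j)) \<in> r"
  shows "i = j"
proof -
  have "(snd (S ! i), fst (S ! (Suc j mod length S))) \<in> r"
    using assms(1,5) strict_alternating_tupleD(3)[OF assms(2,4)] by (blast dest: transD)
  moreover have "Suc j mod length S < length S" using assms(4) by (rule Suc_mod_less)
  ultimately have "Suc j mod length S = Suc i mod length S"
    using strict_alternating_tupleD(4)[OF assms(2,3)] by blast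
  then show ?thesis using Suc_mod_inj assms(3,4) by metis
qed

text \<open>
  An entry \<open>y\<^sub>i\<close> lies below \<open>x\<^bsub>i+1\<^esub>\<close>, so a maximal entry is some \<open>x\<^sub>j\<close>. Conversely every \<open>x\<^sub>j\<close> is
  maximal, since the \<open>x\<close>'s form an antichain and \<open>x\<^sub>j \<le> y\<^sub>i \<le> x\<^bsub>i+1\<^esub>\<close> collapses to an equality. Thus the
  support alone tells which of its elements are first components.
\<close>

lemma maximals_support:
  assumes "trans r" "antisym r" "strict_alternating_tuple X r S"
  shows "maximals r (support S) = fst ` set S"
proof (intro equalityI subsetI)
  fix u assume "u \<in> fst ` set S"
  then obtain i where i: "i < length S" "u = fst (S ! i)" by (auto simp: in_set_conv_nth)
  have "v = u" if v: "v \<in> support S" "(u, v) \<in> r" for v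
    using v(1)
  proof (cases rule: in_supportE)
    case (1 j)
    then show ?thesis using fst_antichain[OF assms(1,3), of i j] i v(2) by simp
  next
    case (2 j)
    define j' where "j' = Suc j mod length S"
    have j': "j' < length S" using Suc_mod_less[OF 2(1)] by (simp add: j'_def)
    have up: "(v, fst (S ! j')) \<in> r"
      using strict_alternating_tupleD(3)[OF assms(3), of j] 2 by (simp add: j'_def)
    then have "(u, fst (S ! j')) \<in> r" using v(2) assms(1) by (blast dest: transD)
    then have "i = j'" using fst_antichain[OF assms(1,3) i(1) j'] i(2) by simp
    then show ?thesis using up v(2) i(2) assms(2) by (blast dest: antisymD)
  qed
  moreover have "u \<in> support S" using \<open>u \<in> fst ` set S\<close> by (simp add: support_def)
  ultimately show "u \<in> maximals r (support S)" by (auto simp: maximals_def)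
next
  fix u assume u: "u \<in> maximals r (support S)"
  then have "u \<in> support S" by (simp add: maximals_def)
  then show "u \<in> fst ` set S"
  proof (cases rule: in_supportE)
    case (1 i)
    then show ?thesis by simp
  next
    case (2 i)
    define x where "x = fst (S ! (Suc i mod length S))"
    have x: "x \<in> fst ` set S"
      unfolding x_def using 2 by (intro imageI nth_mem Suc_mod_less)
    moreover have "(u, x) \<in> r"
      using strict_alternating_tupleD(3)[OF assms(3), of i] 2 by (simp add: x_def)
    ultimately have "x = u" using u by (auto simp: maximals_def support_def)
    then show ?thesis using x by simp
  qed
qed

lemma distinct_fst:
  assumes "refl_on X r" "trans r" "strict_alternating_tuple X r S"
  shows "distinct (map fst S)"
proof -
  have "i = j" if ij: "i < length S" "j < length S" "fst (S ! i) = fst (S ! j)" for i j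
  proof -
    have "S ! i \<in> inc X r" using strict_alternating_tupleD(1)[OF assms(3)] ij(1) nth_mem by blast
    then have "(fst (S ! i), fst (S ! i)) \<in> r" using assms(1) by (auto simp: inc_def refl_on_def)
    then show ?thesis using fst_antichain[OF assms(2,3)] ij by metis
  qed
  then show ?thesis by (auto simp: distinct_conv_nth)
qed

text \<open>
  A chain contains at most one element of each of the two antichains that make up the support.
\<close>

lemma card_support_chain_le_2:
  assumes "trans r" "strict_alternating_tuple X r S"
    and C: "\<And>x y. x \<in> C \<Longrightarrow> y \<in> C \<Longrightarrow> (x, y) \<in> r \<or> (y, x) \<in> r"
  shows "card (support S \<inter> C) \<le> 2"
proof -
  have one: "card (f ` set S \<inter> C) \<le> 1"
    if f: "\<And>i j. i < length S \<Longrightarrow> j < length S \<Longrightarrow> (f (S ! i), f (S ! j)) \<in> r \<Longrightarrow> i = j"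
    for f :: "'a \<times> 'a \<Rightarrow> 'a"
  proof -
    have "x = y" if x: "x \<in> f ` set S \<inter> C" and y: "y \<in> f ` set S \<inter> C" for x y
    proof -
      have index: "\<exists>i<length S. z = f (S ! i)" if "z \<in> f ` set S" for z
      proof -
        obtain p where p: "z = f p" "p \<in> set S" using \<open>z \<in> f ` set S\<close> by blast
        then obtain i where i: "i < length S" "S ! i = p" unfolding in_set_conv_nth by blast
        then show ?thesis using p(1) by (intro exI[of _ i]) simp
      qed
      obtain i where i: "i < length S" "x = f (S ! i)" using index[OF IntD1[OF x]] by blast
      obtain j where j: "j < length S" "y = f (S ! j)" using index[OF IntD1[OF y]] by blast
      have "x \<in> C" "y \<in> C" using x y by simp_all
      from C[OF this] have "i = j"
      proof
        assume "(x, y) \<in> r"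
        then show ?thesis using f[OF i(1) j(1)] i(2) j(2) by simp
      next
        assume "(y, x) \<in> r"
        then show ?thesis using f[OF j(1) i(1)] i(2) j(2) by simp
      qed
      then show ?thesis using i(2) j(2) by simp
    qed
    moreover have "finite (f ` set S \<inter> C)" by simp
    ultimately show ?thesis unfolding One_nat_def by (subst card_le_Suc0_iff_eq) blast+
  qed
  have "card (support S \<inter> C) \<le> card (fst ` set S \<inter> C) + card (snd ` set S \<inter> C)"
    unfolding support_def Int_Un_distrib2 by (rule card_Un_le)
  moreover have "card (fst ` set S \<inter> C) \<le> 1"
    by (rule one) (rule fst_antichain[OF assms(1,2)])
  moreover have "card (snd ` set S \<inter> C) \<le> 1"
    by (rule one) (rule snd_antichain[OF assms(1,2)])
  ultimately show ?thesis by simp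
qed

text \<open>
  The list of first components and the set of all entries determine the tuple. Indeed
  \<open>y\<^sub>i\<close> must be an entry below \<open>x\<^bsub>i+1\<^esub>\<close>, and by strictness the only such entries are \<open>y\<^sub>i\<close> and
  \<open>x\<^bsub>i+1\<^esub>\<close> themselves. So two tuples with the same data could disagree only if both had
  \<open>x\<^bsub>i+1\<^esub>\<close> in this place, and then they agree.
\<close>

lemma tuple_eqI:
  assumes "trans r"
    and S: "strict_alternating_tuple X r S" and T: "strict_alternating_tuple X r T"
    and fst_eq: "map fst S = map fst T" and supp: "support S = support T"
  shows "S = T"
proof -
  have len: "length T = length S" using fst_eq map_eq_imp_length_eq by metis
  have fst_nth: "fst (T ! i) = fst (S ! i)" if "i < length S" for i
    using fst_eq that len by (metis nth_map)
  \<comment> \<open>Stated for an ordered pair of tuples, because it is needed in both directions.\<close>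
  have key: "snd (B ! i) = snd (A ! i) \<or> snd (B ! i) = fst (A ! (Suc i mod length S))"
    if A: "strict_alternating_tuple X r A" and B: "strict_alternating_tuple X r B"
      and AB: "length A = length S" "length B = length S" "support A = support B"
        "\<And>i. i < length S \<Longrightarrow> fst (A ! i) = fst (B ! i)"
      and i: "i < length S" for A B i
  proof -
    define i' where "i' = Suc i mod length S"
    have i': "i' < length S" using Suc_mod_less[OF i] by (simp add: i'_def)
    have le: "(snd (B ! i), fst (A ! i')) \<in> r"
      using strict_alternating_tupleD(3)[OF B, of i] AB i AB(4)[OF i'] by (simp add: i'_def)
    have "snd (B ! i) \<in> support A"
      using AB(2,3) i by (auto simp: support_def)
    then show ?thesis
    proof (cases rule: in_supportE)
      case (1 j)
      then show ?thesis using fst_antichain[OF assms(1) A, of j i'] le i' AB(1) by (simp add: i'_def)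
    next
      case (2 j)
      then have "i' = Suc j mod length S"
        using strict_alternating_tupleD(4)[OF A, of j i'] le i' AB(1) by simp
      then have "j = i" using Suc_mod_inj[of i "length S" j] i 2 AB(1) by (simp add: i'_def)
      then show ?thesis using 2 by simp
    qed
  qed
  have "snd (S ! i) = snd (T ! i)" if i: "i < length S" for i
  proof -
    have "Suc i mod length S < length S" using i by (rule Suc_mod_less)
    then show ?thesis
      using key[OF S T _ len supp _ i] key[OF T S len _ supp[symmetric] _ i] fst_nth by metis
  qed
  then show ?thesis using fst_nth len by (metis nth_equalityI prod_eqI)
qed

section \<open>Counting enumerations and sets with small traces\<close>

text \<open>
  For \<open>k \<ge> 2\<close> this is the number of cyclic arrangements of \<open>k\<close> labelled objects. The value 0 for
  \<open>k < 2\<close> reflects that every strict alternating cycle has length at least 2, and keeps the function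
  monotone.
\<close>

definition cyclic_orders :: "nat \<Rightarrow> nat" where
  "cyclic_orders k = (if k < 2 then 0 else fact (k - 1))"

lemma cyclic_orders_mono: "k \<le> l \<Longrightarrow> cyclic_orders k \<le> cyclic_orders l"
  by (auto simp: cyclic_orders_def intro: fact_mono)

lemma card_enumerations:
  assumes "finite A"
  shows "card {xs. distinct xs \<and> set xs = A} = fact (card A)"
proof -
  have "{xs. distinct xs \<and> set xs = A}
      = {xs. length xs = card A \<and> distinct xs \<and> set xs \<subseteq> A}"
    using assms by (auto simp: distinct_card) (metis card_subset_eq distinct_card)
  then show ?thesis
    using card_lists_distinct_length_eq[OF assms order.refl] by (simp add: fact_prod)
qed

lemma card_enumerations_from:
  assumes "finite A" "a \<in> A"
  shows "card {xs. distinct xs \<and> set xs = A \<and> hd xs = a} = fact (card A - 1)"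
proof -
  have "{xs. distinct xs \<and> set xs = A \<and> hd xs = a}
      = (#) a ` {xs. distinct xs \<and> set xs = A - {a}}" (is "?L = ?R")
  proof (rule equalityI; rule subsetI)
    fix xs assume xs: "xs \<in> ?L"
    then have "xs \<noteq> []" using assms(2) by auto
    then obtain ys where ys: "xs = a # ys" using xs by (cases xs) auto
    have "distinct ys \<and> set ys = A - {a}" using xs unfolding ys by auto
    then show "xs \<in> ?R" unfolding ys by blast
  next
    fix xs assume "xs \<in> ?R"
    then obtain ys where ys: "xs = a # ys" "distinct ys" "set ys = A - {a}" by blast
    then show "xs \<in> ?L" using assms(2) by (simp add: insert_absorb)
  qed
  then show ?thesis
    using card_enumerations[of "A - {a}"] assms by (simp add: card_image card_Diff_singleton)
qed

lemma card_one_or_two_subsets: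
  assumes "finite C"
  shows "real (card {T. T \<subseteq> C \<and> T \<noteq> {} \<and> card T \<le> 2}) = real (card C) * (real (card C) + 1) / 2"
proof -
  let ?n = "card C"
  have "T \<subseteq> C \<and> T \<noteq> {} \<and> card T \<le> 2 \<longleftrightarrow> T \<subseteq> C \<and> (card T = 1 \<or> card T = 2)" for T
    using finite_subset[OF _ assms, of T] by (auto simp: card_gt_0_iff le_Suc_eq numeral_2_eq_2)
  then have "{T. T \<subseteq> C \<and> T \<noteq> {} \<and> card T \<le> 2}
      = {T. T \<subseteq> C \<and> card T = 1} \<union> {T. T \<subseteq> C \<and> card T = 2}" by blast
  also have "card \<dots> = (?n choose 1) + (?n choose 2)"
    using assms by (subst card_Un_disjoint) (auto simp: n_subsets)
  finally show ?thesis
    by (cases "?n") (simp_all add: choose_two real_of_nat_div field_simps)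
qed

text \<open>
  Grouping the sets \<open>U\<close> by the set \<open>J\<close> of colours that they use: such a set is a choice of one or
  two elements from each colour class in \<open>J\<close>, which can be made in \<open>c (c + 1) / 2\<close> ways for a class of
  size \<open>c\<close>.
\<close>

lemma sum_small_traces_le:
  fixes ch :: "'a \<Rightarrow> nat" and g :: "nat \<Rightarrow> nat"
  assumes "finite X" and ch: "ch ` X \<subseteq> {..<w}"
  shows "real (\<Sum>U | U \<subseteq> X \<and> (\<forall>i<w. card (U \<inter> ch -` {i}) \<le> 2). g (card (ch ` U)))
    \<le> (\<Sum>J \<in> Pow {..<w}. real (g (card J)) *
        (\<Prod>i\<in>J. real (card (X \<inter> ch -` {i})) * (real (card (X \<inter> ch -` {i})) + 1) / 2))"
proof -
  define \<U> where "\<U> = {U. U \<subseteq> X \<and> (\<forall>i<w. card (U \<inter> ch -` {i}) \<le> 2)}"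
  define C where "C i = X \<inter> ch -` {i}" for i
  define B where "B i = {T. T \<subseteq> C i \<and> T \<noteq> {} \<and> card T \<le> 2}" for i
  have fin: "finite \<U>" using assms(1) by (auto simp: \<U>_def)
  have finC: "finite (C i)" for i using assms(1) by (simp add: C_def)
  have finB: "finite (B i)" for i using finC by (auto simp: B_def)
  have fibre: "card {U \<in> \<U>. ch ` U = J} \<le> (\<Prod>i\<in>J. card (B i))" if J: "J \<subseteq> {..<w}" for J
  proof -
    have finJ: "finite J" using J finite_subset by blast
    have "card {U \<in> \<U>. ch ` U = J} \<le> card (Pi\<^sub>E J B)"
    proof (rule card_inj_on_le)
      let ?f = "\<lambda>U. restrict (\<lambda>i. U \<inter> ch -` {i}) J"
      show "inj_on ?f {U \<in> \<U>. ch ` U = J}"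
      proof (rule inj_onI)
        fix U V
        assume U: "U \<in> {U \<in> \<U>. ch ` U = J}" and V: "V \<in> {U \<in> \<U>. ch ` U = J}" and eq: "?f U = ?f V"
        have "U \<inter> ch -` {i} = V \<inter> ch -` {i}" if "i \<in> J" for i
          using fun_cong[OF eq, of i] that by simp
        then show "U = V" using U V by blast
      qed
      show "?f ` {U \<in> \<U>. ch ` U = J} \<subseteq> Pi\<^sub>E J B"
      proof (rule image_subsetI, rule PiE_I)
        fix U i assume U: "U \<in> {U \<in> \<U>. ch ` U = J}" and i: "i \<in> J"
        have "i < w" using i J by auto
        moreover have "U \<inter> ch -` {i} \<noteq> {}" using U i by auto
        ultimately show "?f U i \<in> B i" using U i by (auto simp: \<U>_def B_def C_def)
      qed simp
      show "finite (Pi\<^sub>E J B)" using finJ finB by (intro finite_PiE)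
    qed
    then show ?thesis using card_PiE[OF finJ] by metis
  qed
  have "(\<Sum>U\<in>\<U>. g (card (ch ` U)))
      = (\<Sum>J\<in>Pow {..<w}. \<Sum>U | U \<in> \<U> \<and> ch ` U = J. g (card (ch ` U)))"
    using ch by (intro sum.group[symmetric] fin) (auto simp: \<U>_def)
  also have "\<dots> = (\<Sum>J\<in>Pow {..<w}. g (card J) * card {U \<in> \<U>. ch ` U = J})"
    by (intro sum.cong) auto
  also have "\<dots> \<le> (\<Sum>J\<in>Pow {..<w}. g (card J) * (\<Prod>i\<in>J. card (B i)))"
    by (intro sum_mono mult_le_mono order.refl fibre) auto
  finally have "real (\<Sum>U\<in>\<U>. g (card (ch ` U)))
      \<le> real (\<Sum>J\<in>Pow {..<w}. g (card J) * (\<Prod>i\<in>J. card (B i)))"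
    by (rule of_nat_mono)
  also have "\<dots> = (\<Sum>J\<in>Pow {..<w}. real (g (card J)) * (\<Prod>i\<in>J. real (card (B i))))"
    by simp
  finally show ?thesis
    unfolding \<U>_def B_def card_one_or_two_subsets[OF finC] by (simp add: C_def)
qed

section \<open>Strict alternating cycles and a chain partition\<close>

text \<open>
  Each cycle is represented by a tuple that starts at a fixed maximal element of its support \<open>U\<close>. Such a
  tuple is determined by \<open>U\<close> and an enumeration of the \<open>k\<close> maximal elements of \<open>U\<close> with prescribed
  first element, so \<open>U\<close> accounts for at most \<open>(k - 1)!\<close> cycles. These \<open>k\<close> elements lie in different
  chains, so \<open>k\<close> is at most the number of chains that \<open>U\<close> meets.
\<close>

lemma card_strict_alternating_cycles_le:
  assumes "finite X" "partial_order_on X r" and ch: "ch ` X \<subseteq> {..<w}"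
    and chain: "\<And>x y. x \<in> X \<Longrightarrow> y \<in> X \<Longrightarrow> ch x = ch y \<Longrightarrow> (x, y) \<in> r \<or> (y, x) \<in> r"
  shows "finite (strict_alternating_cycles X r)"
    and "card (strict_alternating_cycles X r)
      \<le> (\<Sum>U | U \<subseteq> X \<and> (\<forall>i<w. card (U \<inter> ch -` {i}) \<le> 2). cyclic_orders (card (ch ` U)))"
proof -
  note po = partial_order_onD(1-3)[OF assms(2)]
  define \<U> where "\<U> = {U. U \<subseteq> X \<and> (\<forall>i<w. card (U \<inter> ch -` {i}) \<le> 2)}"
  define \<V> where
    "\<V> = {U \<in> \<U>. 2 \<le> card (maximals r U) \<and> card (maximals r U) \<le> card (ch ` U)}"
  \<comment> \<open>The prescribed starting point of a cycle with support \<open>U\<close>.\<close>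
  define top where "top U = (SOME u. u \<in> maximals r U)" for U
  define L where "L U = {xs. distinct xs \<and> set xs = maximals r U \<and> hd xs = top U}" for U
  define R where "R = {S. strict_alternating_tuple X r S \<and> fst (hd S) = top (support S)}"
  define \<phi> where "\<phi> S = (support S, map fst S)" for S :: "('a \<times> 'a) list"
  have fin\<U>: "finite \<U>" using assms(1) by (auto simp: \<U>_def)
  then have fin\<V>: "finite \<V>" by (simp add: \<V>_def)
  have fin_max: "finite (maximals r U)" if "U \<in> \<V>" for U
    using that assms(1) by (auto simp: \<V>_def \<U>_def maximals_def intro: finite_subset)
  have top: "top U \<in> maximals r U" if "maximals r U \<noteq> {}" for U
    unfolding top_def using that by (simp add: some_in_eq)
  have cardL: "card (L U) = cyclic_orders (card (maximals r U))" if "U \<in> \<V>" for U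
  proof -
    have "2 \<le> card (maximals r U)" using that by (simp add: \<V>_def)
    moreover from this have "maximals r U \<noteq> {}" by auto
    ultimately show ?thesis
      using card_enumerations_from[OF fin_max[OF that] top] by (simp add: L_def cyclic_orders_def)
  qed
  have finL: "finite (L U)" if "U \<in> \<V>" for U
    using cardL[OF that] that by (intro card_ge_0_finite) (simp add: cyclic_orders_def \<V>_def)
  have inj: "inj_on \<phi> R"
    using tuple_eqI[OF po(2)] by (auto simp: inj_on_def \<phi>_def R_def)
  have \<phi>R: "\<phi> ` R \<subseteq> Sigma \<V> L"
  proof (rule image_subsetI)
    fix S assume "S \<in> R"
    then have S: "strict_alternating_tuple X r S" "fst (hd S) = top (support S)"
      by (auto simp: R_def)
    have max: "maximals r (support S) = fst ` set S"
      using maximals_support[OF po(2,3) S(1)] .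
    have dist: "distinct (map fst S)" using distinct_fst[OF po(1,2) S(1)] .
    then have card_max: "card (fst ` set S) = length S"
      using distinct_card[OF dist] by simp
    have sub: "support S \<subseteq> X" using support_subset[OF S(1)] .
    have "support S \<in> \<U>"
    proof -
      have "card (support S \<inter> ch -` {i}) \<le> 2" for i
      proof -
        have "support S \<inter> ch -` {i} = support S \<inter> (X \<inter> ch -` {i})" using sub by blast
        also have "card \<dots> \<le> 2"
          using chain by (intro card_support_chain_le_2[OF po(2) S(1)]) auto
        finally show ?thesis .
      qed
      then show ?thesis using sub by (simp add: \<U>_def)
    qed
    moreover have "card (maximals r (support S)) \<le> card (ch ` support S)"
    proof -
      have fs: "fst ` set S \<subseteq> support S" by (simp add: support_def)
      have "inj_on ch (fst ` set S)"
      proof (rule inj_onI)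
        fix x y assume xy: "x \<in> fst ` set S" "y \<in> fst ` set S" "ch x = ch y"
        then have "(x, y) \<in> r \<or> (y, x) \<in> r" using chain fs sub by blast
        then show "x = y" using xy fs unfolding max[symmetric] maximals_def by blast
      qed
      then have "card (fst ` set S) = card (ch ` fst ` set S)" by (simp add: card_image)
      also have "\<dots> \<le> card (ch ` support S)"
        using fs by (intro card_mono image_mono) (auto simp: support_def)
      finally show ?thesis by (simp add: max)
    qed
    ultimately have "support S \<in> \<V>"
      using strict_alternating_tuple_length_ge_2[OF S(1)] card_max by (simp add: \<V>_def max)
    moreover have "map fst S \<in> L (support S)"
      using dist S(2) strict_alternating_tuple_length_ge_2[OF S(1)] max by (cases S) (auto simp: L_def)
    ultimately show "\<phi> S \<in> Sigma \<V> L" by (simp add: \<phi>_def)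
  qed
  have finS: "finite (Sigma \<V> L)" using fin\<V> finL by (intro finite_SigmaI)
  have finR: "finite R" using inj_on_finite[OF inj \<phi>R finS] .
  have cycles: "strict_alternating_cycles X r \<subseteq> (\<lambda>S. cyclic_shift `` {S}) ` R"
  proof
    fix c assume "c \<in> strict_alternating_cycles X r"
    then obtain S where S: "strict_alternating_tuple X r S" "c = cyclic_shift `` {S}"
      by (auto simp: strict_alternating_cycles_def elim: quotientE)
    have "S \<noteq> []" using strict_alternating_tupleD(2)[OF S(1)] by simp
    then have "top (support S) \<in> fst ` set S"
      using top[of "support S"] unfolding maximals_support[OF po(2,3) S(1)] by simp
    then obtain i where i: "i < length S" "fst (S ! i) = top (support S)"
      by (auto simp: in_set_conv_nth)
    have "rotate i S \<in> R"
      using strict_alternating_tuple_rotate[OF S(1), of i] i \<open>S \<noteq> []\<close>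
      by (simp add: R_def hd_rotate_conv_nth)
    moreover have "c = cyclic_shift `` {rotate i S}"
      unfolding S(2) by (intro equiv_class_eq[OF equiv_cyclic_shift]) (auto simp: cyclic_shift_def)
    ultimately show "c \<in> (\<lambda>S. cyclic_shift `` {S}) ` R" by blast
  qed
  then show "finite (strict_alternating_cycles X r)" using finR finite_subset by blast
  have "card (strict_alternating_cycles X r) \<le> card R"
    using cycles finR by (meson card_image_le card_mono finite_imageI le_trans)
  also have "\<dots> \<le> card (Sigma \<V> L)" using card_inj_on_le[OF inj \<phi>R finS] .
  also have "\<dots> = (\<Sum>U\<in>\<V>. cyclic_orders (card (maximals r U)))"
    using fin\<V> finL cardL by simp
  also have "\<dots> \<le> (\<Sum>U\<in>\<V>. cyclic_orders (card (ch ` U)))"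
    by (intro sum_mono cyclic_orders_mono) (simp add: \<V>_def)
  also have "\<dots> \<le> (\<Sum>U\<in>\<U>. cyclic_orders (card (ch ` U)))"
    using fin\<U> by (intro sum_mono2) (auto simp: \<V>_def)
  finally show "card (strict_alternating_cycles X r)
      \<le> (\<Sum>U | U \<subseteq> X \<and> (\<forall>i<w. card (U \<inter> ch -` {i}) \<le> 2). cyclic_orders (card (ch ` U)))"
    by (simp add: \<U>_def)
qed

section \<open>Smoothing\<close>

text \<open>
  In terms of the elementary symmetric polynomials \<open>e\<^sub>k\<close>, this is \<open>\<Sum>\<^sub>k g(k) e\<^sub>k(t)\<close>.
\<close>

definition weighted_products :: "(nat \<Rightarrow> nat) \<Rightarrow> 'i set \<Rightarrow> ('i \<Rightarrow> real) \<Rightarrow> real" where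
  "weighted_products g I t = (\<Sum>J\<in>Pow I. real (g (card J)) * prod t J)"

lemma sum_Pow_insert:
  assumes "finite I" "i \<notin> I"
  shows "(\<Sum>J\<in>Pow (insert i I). F J) = (\<Sum>J\<in>Pow I. F J + (F (insert i J) :: real))"
proof -
  have "inj_on (insert i) (Pow I)" using assms(2) by (auto simp: inj_on_def)
  then have "(\<Sum>J\<in>insert i ` Pow I. F J) = (\<Sum>J\<in>Pow I. F (insert i J))"
    by (simp add: sum.reindex)
  moreover have "Pow I \<inter> insert i ` Pow I = {}" using assms(2) by auto
  ultimately show ?thesis
    using assms(1) by (simp add: Pow_insert sum.union_disjoint sum.distrib)
qed

text \<open>
  This reduces the comparison of two functions that differ only at \<open>i\<close> and \<open>j\<close> to a comparison of
  the sums and the products of their values there.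
\<close>

lemma weighted_products_insert2:
  assumes "finite I" "i \<notin> I" "j \<notin> I" "i \<noteq> j"
  shows "weighted_products g (insert i (insert j I)) t =
    (\<Sum>J\<in>Pow I. prod t J * (real (g (card J)) + real (g (card J + 1)) * (t i + t j)
        + real (g (card J + 2)) * (t i * t j)))"
proof -
  have "weighted_products g (insert i (insert j I)) t =
    (\<Sum>J\<in>Pow I. (real (g (card J)) * prod t J + real (g (card (insert i J))) * prod t (insert i J))
      + (real (g (card (insert j J))) * prod t (insert j J)
        + real (g (card (insert i (insert j J)))) * prod t (insert i (insert j J))))"
    using assms unfolding weighted_products_def
    by (simp add: sum_Pow_insert[of "insert j I"] sum_Pow_insert[of I] insert_commute)
  also have "\<dots> = (\<Sum>J\<in>Pow I. prod t J * (real (g (card J)) + real (g (card J + 1)) * (t i + t j)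
        + real (g (card J + 2)) * (t i * t j)))"
  proof (rule sum.cong[OF refl])
    fix J assume "J \<in> Pow I"
    then have "finite J" "i \<notin> J" "j \<notin> J" using assms finite_subset by auto
    then show "(real (g (card J)) * prod t J + real (g (card (insert i J))) * prod t (insert i J))
      + (real (g (card (insert j J))) * prod t (insert j J)
        + real (g (card (insert i (insert j J)))) * prod t (insert i (insert j J))) =
      prod t J * (real (g (card J)) + real (g (card J + 1)) * (t i + t j)
        + real (g (card J + 2)) * (t i * t j))"
      using assms(4) by (simp add: algebra_simps)
  qed
  finally show ?thesis .
qed

text \<open>
  With \<open>a = g (k + 1) \<le> b = g (k + 2)\<close>, the two relevant terms are
  \<open>a (s + u) + b s u = a ((1 + s) (1 + u) - 1) + (b - a) s u\<close>. So although \<open>s + u\<close> may decrease in the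
  replacement, it suffices that \<open>s u\<close> and \<open>(1 + s) (1 + u)\<close> increase.
\<close>

lemma weighted_products_mono2:
  assumes "finite I" "i \<in> I" "j \<in> I" "i \<noteq> j" "mono g"
    and nonneg: "\<And>l. l \<in> I \<Longrightarrow> 0 \<le> t l"
    and same: "\<And>l. l \<in> I \<Longrightarrow> l \<noteq> i \<Longrightarrow> l \<noteq> j \<Longrightarrow> t' l = t l"
    and prod: "t i * t j \<le> t' i * t' j"
    and prod1: "(1 + t i) * (1 + t j) \<le> (1 + t' i) * (1 + t' j)"
  shows "weighted_products g I t \<le> weighted_products g I t'"
proof -
  define I' where "I' = I - {i, j}"
  have I: "I = insert i (insert j I')" "finite I'" "i \<notin> I'" "j \<notin> I'"
    using assms(1-3) by (auto simp: I'_def)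
  show ?thesis
    unfolding I(1) weighted_products_insert2[OF I(2-4) assms(4)]
  proof (rule sum_mono)
    fix J assume "J \<in> Pow I'"
    then have J: "J \<subseteq> I'" by simp
    have eq: "prod t' J = prod t J" using J same by (intro prod.cong) (auto simp: I'_def)
    have nn: "0 \<le> prod t J" using J nonneg by (intro prod_nonneg) (auto simp: I'_def)
    let ?a = "real (g (card J + 1))" and ?b = "real (g (card J + 2))"
    have ab: "?a \<le> ?b" using assms(5) by (simp add: monoD)
    have split: "?a * (s + u) + ?b * (s * u) = ?a * ((1 + s) * (1 + u) - 1) + (?b - ?a) * (s * u)"
      for s u :: real by (simp add: algebra_simps)
    have "?a * (t i + t j) + ?b * (t i * t j) \<le> ?a * (t' i + t' j) + ?b * (t' i * t' j)"
      unfolding split using prod prod1 ab by (intro add_mono mult_left_mono) auto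
    then show "prod t J * (real (g (card J)) + ?a * (t i + t j) + ?b * (t i * t j))
      \<le> prod t' J * (real (g (card J)) + ?a * (t' i + t' j) + ?b * (t' i * t' j))"
      unfolding eq using nn by (intro mult_left_mono) auto
  qed
qed

text \<open>
  For a natural number \<open>x\<close> this is the number of nonempty sets of at most two elements taken from a chain
  of size \<open>x\<close>. It is taken as a function on the reals because the mean chain size need not be an integer.
\<close>

definition tri :: "real \<Rightarrow> real" where
  "tri x = x * (x + 1) / 2"

lemma tri_mono:
  assumes "0 \<le> x" "x \<le> y"
  shows "tri x \<le> tri y"
  using mult_mono[of x y "x + 1" "y + 1"] assms by (simp add: tri_def)

text \<open>
  For a fixed sum \<open>s\<close>, both products are quadratic polynomials in \<open>p = a b\<close>. The first is increasing
  for all \<open>p \<ge> 0\<close>; the second contains \<open>p (p + s - 3)\<close>, which is increasing where \<open>p + s \<ge> 3\<close>. The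
  lower bound 1 on the values ensures this.
\<close>

lemma tri_smoothing:
  assumes "1 \<le> a" "1 \<le> b" "1 \<le> c" "1 \<le> d" "a + b = c + d" "a * b \<le> c * d"
  shows "tri a * tri b \<le> tri c * tri d"
    and "(1 + tri a) * (1 + tri b) \<le> (1 + tri c) * (1 + tri d)"
proof -
  define s where "s = a + b"
  have s: "s = c + d" "2 \<le> s" using assms by (auto simp: s_def)
  have p1: "1 \<le> a * b" using mult_mono[of 1 a 1 b] assms by simp
  have prod: "tri x * tri y = x * y * (x * y + (x + y) + 1) / 4" for x y
    by (simp add: tri_def field_simps)
  have prod1: "(1 + tri x) * (1 + tri y) =
      1 + ((x + y)\<^sup>2 + (x + y)) / 2 + x * y * (x * y + (x + y) - 3) / 4" for x y
    by (simp add: tri_def field_simps power2_eq_square)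
  show "tri a * tri b \<le> tri c * tri d"
  proof -
    have "a * b * (a * b + s + 1) \<le> c * d * (c * d + s + 1)"
      by (rule mult_mono) (use assms(6) p1 s(2) in linarith)+
    then show ?thesis unfolding prod using s by (simp add: s_def)
  qed
  have "a * b * (a * b + s - 3) \<le> c * d * (c * d + s - 3)"
    by (rule mult_mono) (use assms(6) p1 s(2) in linarith)+
  then show "(1 + tri a) * (1 + tri b) \<le> (1 + tri c) * (1 + tri d)"
    unfolding prod1 using s by (simp add: s_def)
qed

lemma exists_below_and_above_mean:
  fixes a :: "'i \<Rightarrow> real"
  assumes "finite I" "sum a I = real (card I) * m" "\<exists>i\<in>I. a i \<noteq> m"
  obtains i j where "i \<in> I" "j \<in> I" "a i < m" "m < a j"
proof -
  have zero: "(\<Sum>i\<in>I. a i - m) = 0" using assms(2) by (simp add: sum_subtractf)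
  have "\<exists>i\<in>I. a i < m"
  proof (rule ccontr)
    assume "\<not> ?thesis"
    then have "\<forall>i\<in>I. a i - m = 0"
      using sum_nonneg_eq_0_iff[OF assms(1), of "\<lambda>i. a i - m"] zero by force
    then show False using assms(3) by auto
  qed
  moreover have "\<exists>i\<in>I. m < a i"
  proof (rule ccontr)
    assume "\<not> ?thesis"
    then have "\<forall>i\<in>I. a i - m = 0"
      using sum_nonneg_eq_0_iff[OF assms(1), of "\<lambda>i. m - a i"] assms(2)
      by (force simp: sum_subtractf)
    then show False using assms(3) by auto
  qed
  ultimately show thesis using that by blast
qed

text \<open>
  Smoothing: while the values are not all equal to their mean \<open>m\<close>, take one below and one above \<open>m\<close>
  and shift both, at constant sum, until the first equals \<open>m\<close>. Their product increases by
  \<open>(m - a\<^sub>i) (a\<^sub>j - m)\<close>, and one more value equals \<open>m\<close>.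
\<close>

lemma weighted_products_le_balanced:
  fixes a :: "'i \<Rightarrow> real"
  assumes "finite I" "mono g" "\<And>i. i \<in> I \<Longrightarrow> 1 \<le> a i" "sum a I = real (card I) * m"
  shows "weighted_products g I (\<lambda>i. tri (a i)) \<le> weighted_products g I (\<lambda>_. tri m)"
  using assms(3,4)
proof (induction "card {i \<in> I. a i \<noteq> m}" arbitrary: a rule: less_induct)
  case less
  show ?case
  proof (cases "\<exists>i\<in>I. a i \<noteq> m")
    case False
    then have "weighted_products g I (\<lambda>i. tri (a i)) = weighted_products g I (\<lambda>_. tri m)"
      unfolding weighted_products_def by (intro sum.cong prod.cong arg_cong2[where f = "(*)"]) auto
    then show ?thesis by simp
  next
    case True
    then obtain i j where ij: "i \<in> I" "j \<in> I" "a i < m" "m < a j"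
      using exists_below_and_above_mean[OF assms(1) less.prems(2)] by metis
    then have "i \<noteq> j" by auto
    define b where "b = a(i := m, j := a i + a j - m)"
    have b: "b i = m" "b j = a i + a j - m" "\<And>l. l \<noteq> i \<Longrightarrow> l \<noteq> j \<Longrightarrow> b l = a l"
      using \<open>i \<noteq> j\<close> by (auto simp: b_def)
    have ai: "1 \<le> a i" "1 \<le> a j" using less.prems(1) ij by auto
    have ge1: "1 \<le> b l" if "l \<in> I" for l
      using less.prems(1)[OF that] ai ij by (auto simp: b_def)
    have remove: "sum f I = f i + (f j + sum f (I - {i} - {j}))" for f :: "'i \<Rightarrow> real"
      using assms(1) ij(1,2) \<open>i \<noteq> j\<close> sum.remove[of I i f] sum.remove[of "I - {i}" j f] by simp
    have "sum b I = b i + (b j + sum b (I - {i} - {j}))" by (rule remove)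
    also have "sum b (I - {i} - {j}) = sum a (I - {i} - {j})"
      using b(3) by (intro sum.cong) auto
    also have "b i + (b j + \<dots>) = a i + (a j + \<dots>)" using b by simp
    also have "\<dots> = sum a I" by (rule remove[symmetric])
    finally have sum: "sum b I = real (card I) * m" using less.prems(2) by simp
    have "{l \<in> I. b l \<noteq> m} \<subset> {l \<in> I. a l \<noteq> m}"
    proof (rule psubsetI)
      show "{l \<in> I. b l \<noteq> m} \<subseteq> {l \<in> I. a l \<noteq> m}"
      proof (rule subsetI)
        fix l assume l: "l \<in> {l \<in> I. b l \<noteq> m}"
        then have "l \<noteq> i" using b(1) by auto
        then show "l \<in> {l \<in> I. a l \<noteq> m}"
          using l b(3)[of l] ij(4) by (cases "l = j") auto
      qed
      have "i \<in> {l \<in> I. a l \<noteq> m}" "i \<notin> {l \<in> I. b l \<noteq> m}" using ij b(1) by auto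
      then show "{l \<in> I. b l \<noteq> m} \<noteq> {l \<in> I. a l \<noteq> m}" by blast
    qed
    then have "card {l \<in> I. b l \<noteq> m} < card {l \<in> I. a l \<noteq> m}"
      using assms(1) by (intro psubset_card_mono) auto
    then have IH: "weighted_products g I (\<lambda>i. tri (b i)) \<le> weighted_products g I (\<lambda>_. tri m)"
      using less.hyps ge1 sum by blast
    have "0 \<le> (m - a i) * (a j - m)" using ij by simp
    then have le: "a i * a j \<le> b i * b j" unfolding b by (simp add: algebra_simps)
    have "a i + a j = b i + b j" using b by simp
    note smooth = tri_smoothing[OF ai ge1[OF ij(1)] ge1[OF ij(2)] this le]
    have nonneg: "0 \<le> tri (a l)" if "l \<in> I" for l
      using less.prems(1)[OF that] by (simp add: tri_def)
    have same: "tri (b l) = tri (a l)" if "l \<noteq> i" "l \<noteq> j" for l using b(3)[OF that] by simp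
    have "weighted_products g I (\<lambda>i. tri (a i)) \<le> weighted_products g I (\<lambda>i. tri (b i))"
      by (rule weighted_products_mono2[OF assms(1) ij(1,2) \<open>i \<noteq> j\<close> assms(2) nonneg same smooth])
    then show ?thesis using IH by simp
  qed
qed

lemma weighted_products_const:
  assumes "finite I"
  shows "weighted_products g I (\<lambda>_. c) = (\<Sum>k\<le>card I. real (card I choose k) * real (g k) * c ^ k)"
proof -
  have "weighted_products g I (\<lambda>_. c) = (\<Sum>J\<in>Pow I. real (g (card J)) * c ^ card J)"
    by (simp add: weighted_products_def)
  also have "\<dots> = (\<Sum>k\<le>card I. \<Sum>J | J \<in> Pow I \<and> card J = k. real (g (card J)) * c ^ card J)"
    using assms by (intro sum.group[symmetric]) (auto intro: card_mono)
  also have "\<dots> = (\<Sum>k\<le>card I. \<Sum>J | J \<in> Pow I \<and> card J = k. real (g k) * c ^ k)"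
    by (intro sum.cong) auto
  also have "\<dots> = (\<Sum>k\<le>card I. real (card I choose k) * real (g k) * c ^ k)"
    using assms by (simp add: n_subsets mult.assoc)
  finally show ?thesis .
qed

section \<open>The bound\<close>

theorem corollary8p4:
  fixes X :: "'a set" and r :: "'a rel" and w n :: nat
  assumes "w > 0" and "n > 0"
    and "finite X" and "X \<noteq> {}" and "partial_order_on X r"
    and "poset_width X r = w"
    and "card X \<le> n"
  shows "finite (strict_alternating_cycles X r) \<and>
         real (card (strict_alternating_cycles X r)) \<le> s_bound w n"
proof -
  note po = partial_order_onD(1-3)[OF assms(5)]
  have "\<And>A. antichain_in X r A \<Longrightarrow> card A \<le> w"
    using card_antichain_le_poset_width[OF assms(3)] assms(6) by blast
  from Dilworth_chain_colouring[OF assms(3) po this] obtain ch where ch: "ch ` X \<subseteq> {..<w}"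
    and chain: "\<And>x y. x \<in> X \<Longrightarrow> y \<in> X \<Longrightarrow> ch x = ch y \<Longrightarrow> (x, y) \<in> r \<or> (y, x) \<in> r"
    by blast
  \<comment> \<open>No chain is empty: an antichain of size \<open>w\<close> has an element in each. So all sizes are at least 1, as smoothing requires.\<close>
  have onto: "ch ` X = {..<w}"
  proof -
    obtain A where A: "antichain_in X r A" "card A = w"
      using poset_width_attained[OF assms(3)] assms(6) by metis
    then have AX: "A \<subseteq> X" by (simp add: antichain_in_iff)
    have "inj_on ch A"
    proof (rule inj_onI)
      fix x y assume xy: "x \<in> A" "y \<in> A" "ch x = ch y"
      then have "(x, y) \<in> r \<or> (y, x) \<in> r" using chain AX by blast
      then show "x = y" using xy A(1) by (auto simp: antichain_in_iff)
    qed
    then have "card (ch ` A) = w" using A(2) by (simp add: card_image)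
    moreover have "ch ` A \<subseteq> {..<w}" using AX ch by blast
    ultimately have "ch ` A = {..<w}" by (intro card_subset_eq) auto
    then show ?thesis using AX ch by blast
  qed
  define c where "c i = real (card (X \<inter> ch -` {i}))" for i
  have c1: "1 \<le> c i" if "i \<in> {..<w}" for i
  proof -
    have "X \<inter> ch -` {i} \<noteq> {}" using that onto by (metis disjoint_iff imageE vimage_singleton_eq)
    then have "0 < card (X \<inter> ch -` {i})" using assms(3) by (simp add: card_gt_0_iff)
    then show ?thesis by (simp add: c_def)
  qed
  have "sum c {..<w} = real (card X)"
  proof -
    have "card X = (\<Sum>i<w. \<Sum>x | x \<in> X \<and> ch x = i. 1)"
      using sum.group[OF assms(3) finite_lessThan ch, of "\<lambda>_. 1 :: nat"] by simp
    also have "\<dots> = (\<Sum>i<w. card (X \<inter> ch -` {i}))"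
      by (intro sum.cong refl) (simp add: Int_def vimage_def)
    finally show ?thesis by (simp add: c_def)
  qed
  then have sum_c: "sum c {..<w} = real (card {..<w}) * (real (card X) / real w)"
    using assms(1) by simp
  have "real (card (strict_alternating_cycles X r))
      \<le> weighted_products cyclic_orders {..<w} (\<lambda>i. tri (c i))"
    using of_nat_mono[OF card_strict_alternating_cycles_le(2)[OF assms(3,5) ch chain]]
      sum_small_traces_le[OF assms(3) ch, of cyclic_orders]
    unfolding weighted_products_def tri_def c_def by (rule order.trans)
  also have "\<dots> \<le> weighted_products cyclic_orders {..<w} (\<lambda>_. tri (real (card X) / real w))"
    using cyclic_orders_mono c1 sum_c by (intro weighted_products_le_balanced) (auto simp: mono_def)
  also have "\<dots> = (\<Sum>k\<le>w. real (w choose k) * real (cyclic_orders k) * tri (real (card X) / real w) ^ k)"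
    by (simp add: weighted_products_const)
  also have "\<dots> \<le> (\<Sum>k\<le>w. real (w choose k) * real (cyclic_orders k) * tri (real n / real w) ^ k)"
  proof (intro sum_mono mult_left_mono power_mono)
    have "real (card X) / real w \<le> real n / real w" using assms(7) by (intro divide_right_mono) auto
    then show "tri (real (card X) / real w) \<le> tri (real n / real w)"
      by (intro tri_mono) auto
  qed (simp_all add: tri_def)
  also have "\<dots> = (\<Sum>k=2..w. real (w choose k) * real (cyclic_orders k) * tri (real n / real w) ^ k)"
    by (intro sum.mono_neutral_right) (auto simp: cyclic_orders_def)
  also have "\<dots> = s_bound w n"
  proof -
    have "tri (real n / real w) = real n * (real n + real w) / (2 * (real w)\<^sup>2)"
      using assms(1) by (simp add: tri_def field_simps power2_eq_square)
    then show ?thesis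
      unfolding s_bound_def by (intro sum.cong) (auto simp: cyclic_orders_def)
  qed
  finally show ?thesis
    using card_strict_alternating_cycles_le(1)[OF assms(3,5) ch chain] by blast
qed

end
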